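(* Fix an integer $d\ge 3$ and let $G_n$ be a uniformly random $d$-regular graph on $n$ vertices ($nd$ even). Then for every fixed $\delta\ge 0$, $$\Pr\big(G_n \text{ is } \delta\text{-hyperbolic}\big)\longrightarrow 0 \quad\text{as } n\to\infty.$$ In particular, the family of random $d$-regular graphs is not asymptotically $\delta$-hyperbolic for any $\delta\ge0$, asymptotically almost surely.
   Context: Graphs are endowed with the shortest-path metric $d_G$ (each edge has length $1$). A random $d$-regular graph means a graph chosen uniformly at random among all $d$-regular simple graphs on the vertex set $\{1,\dots,n\}$. A geodesic triangle with vertices $a,b,c$ consists of a choice of shortest paths $[ab],[bc],[ca]$; it is $\delta$-thin if each of its sides lies in the $\delta$-neighborhood of the union of the other two, e.g. $[ab]\subseteq \mathcal N([bc],\delta)\cup\mathcal N([ca],\delta)$, where $\mathcal N(S,\delta)$ is the set of vertices at distance at most $\delta$ from $S$. A graph is $\delta$-hyperbolic if all its geodesic triangles are $\delta$-thin. (Equivalently, up to changing $\delta$ by a bounded factor, Gromov's four-point condition $d(x_1,x_3)+d(x_2,x_4)\le \max\{d(x_1,x_2)+d(x_3,x_4),\,d(x_1,x_4)+d(x_2,x_3)\}+2\delta$ for all vertices $x_1,\dots,x_4$.) A family $(G_n)$ is asymptotically $\delta$-hyperbolic if $G_n$ is $\delta$-hyperbolic for all sufficiently large $n$. *)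

theory Defs
  imports "HOL-Probability.Probability"
begin

definition simple_graph :: "nat \<Rightarrow> nat set set \<Rightarrow> bool" where
  "simple_graph n E \<longleftrightarrow> (\<forall>e\<in>E. e \<subseteq> {1..n} \<and> card e = 2)"

definition regular :: "nat \<Rightarrow> nat \<Rightarrow> nat set set \<Rightarrow> bool" where
  "regular n d E \<longleftrightarrow> (\<forall>v\<in>{1..n}. card {e\<in>E. v \<in> e} = d)"

definition regular_graphs :: "nat \<Rightarrow> nat \<Rightarrow> nat set set set" where
  "regular_graphs n d = {E. simple_graph n E \<and> regular n d E}"

text \<open>A path is a nonempty list of vertices of the graph, consecutive ones adjacent.
  Its length (number of edges) is length p - 1.\<close>
definition is_path :: "nat \<Rightarrow> nat set set \<Rightarrow> nat list \<Rightarrow> bool" where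
  "is_path n E p \<longleftrightarrow> p \<noteq> [] \<and> set p \<subseteq> {1..n} \<and>
     (\<forall>i. Suc i < length p \<longrightarrow> {p ! i, p ! Suc i} \<in> E)"

definition is_geodesic :: "nat \<Rightarrow> nat set set \<Rightarrow> nat list \<Rightarrow> bool" where
  "is_geodesic n E p \<longleftrightarrow> is_path n E p \<and>
     (\<forall>q. is_path n E q \<and> hd q = hd p \<and> last q = last p \<longrightarrow> length p \<le> length q)"

definition in_nbhd :: "nat \<Rightarrow> nat set set \<Rightarrow> nat set \<Rightarrow> real \<Rightarrow> nat \<Rightarrow> bool" where
  "in_nbhd n E S \<delta> x \<longleftrightarrow> (\<exists>q. is_path n E q \<and> hd q = x \<and> last q \<in> S \<and>
      real (length q - 1) \<le> \<delta>)"

definition thin_triangle :: "nat \<Rightarrow> nat set set \<Rightarrow> real \<Rightarrow> nat list \<Rightarrow> nat list \<Rightarrow> nat list \<Rightarrow> bool" where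
  "thin_triangle n E \<delta> p q r \<longleftrightarrow>
     (\<forall>x\<in>set p. in_nbhd n E (set q \<union> set r) \<delta> x) \<and>
     (\<forall>x\<in>set q. in_nbhd n E (set r \<union> set p) \<delta> x) \<and>
     (\<forall>x\<in>set r. in_nbhd n E (set p \<union> set q) \<delta> x)"

definition hyperbolic :: "nat \<Rightarrow> nat set set \<Rightarrow> real \<Rightarrow> bool" where
  "hyperbolic n E \<delta> \<longleftrightarrow>
     (\<forall>p q r. is_geodesic n E p \<and> is_geodesic n E q \<and> is_geodesic n E r \<and>
        last p = hd q \<and> last q = hd r \<and> last r = hd p \<longrightarrow> thin_triangle n E \<delta> p q r)"

end

(* A cycle of minimal length among those that are not sums modulo 2 of shorter cycles is isometric,
   and a long isometric cycle contains a fat geodesic triangle.  Hence in a hyperbolic graph the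
   cycles of bounded length generate the cycle space, whose dimension for a d-regular graph is at
   least n d / 2 - n, so there are at least n / 2 of them (as rooted oriented cycles).  On the other
   hand, switching the edge uv of a k-cycle with a disjoint edge xy shows that a random d-regular
   graph has at most d ^ (k + 1) such k-cycles on average, and Markov's inequality concludes. *)

theory Submission
  imports Defs
begin

section \<open>Walks\<close>

text \<open>The cycle space is never built. An edge set \<open>A\<close> acts as a GF(2) functional
  on walks, and generation by short cycles becomes: a functional vanishing on them vanishes on all
  closed walks, hence is a cut. Counting the \<open>2 ^ card E\<close> edge sets then replaces a
  rank computation. The uniform law on simple regular graphs offers no independence between edges,
  so the mean number of cycles is bounded by double counting: the \<open>n\<close> or more
  switchings available at each cycle cancel the factor \<open>n\<close> for the starting vertex of a
  walk, which makes the bound independent of \<open>n\<close>.\<close>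

lemma is_path_iff_successively:
  "is_path n E p \<longleftrightarrow> p \<noteq> [] \<and> set p \<subseteq> {1..n} \<and> successively (\<lambda>a b. {a, b} \<in> E) p"
  by (auto simp: is_path_def successively_conv_nth)

lemma is_path_append:
  assumes "xs \<noteq> []" "ys \<noteq> []"
  shows "is_path n E (xs @ ys) \<longleftrightarrow> is_path n E xs \<and> is_path n E ys \<and> {last xs, hd ys} \<in> E"
  using assms by (auto simp: is_path_iff_successively successively_append_iff)

lemma is_path_rev: "is_path n E (rev p) \<longleftrightarrow> is_path n E p"
  by (auto simp: is_path_iff_successively insert_commute)

lemma is_path_Cons:
  "is_path n E (a # p) \<longleftrightarrow> a \<in> {1..n} \<and> (p = [] \<or> is_path n E p \<and> {a, hd p} \<in> E)"
  by (cases p) (auto simp: is_path_iff_successively)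

lemma is_path_join:
  assumes "is_path n E xs" "is_path n E ys" "last xs = hd ys"
  shows "is_path n E (xs @ tl ys)"
  using assms by (cases ys; cases "tl ys") (auto simp: is_path_iff_successively successively_append_iff)

lemma is_path_take: "is_path n E p \<Longrightarrow> 0 < k \<Longrightarrow> is_path n E (take k p)"
  by (auto simp: is_path_def dest: in_set_takeD)

lemma is_path_drop: "is_path n E p \<Longrightarrow> k < length p \<Longrightarrow> is_path n E (drop k p)"
  by (auto simp: is_path_def dest: in_set_dropD)

text \<open>The number of steps lying in \<open>A\<close>, modulo 2; \<open>\<noteq>\<close> on
  booleans is addition in GF(2). An edge traversed back and forth cancels.\<close>

fun walk_parity :: "nat set set \<Rightarrow> nat list \<Rightarrow> bool" where
  "walk_parity A (a # b # xs) = (({a, b} \<in> A) \<noteq> walk_parity A (b # xs))"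
| "walk_parity A _ = False"

lemma walk_parity_append_Cons:
  "walk_parity A (xs @ a # ys) = (walk_parity A (xs @ [a]) \<noteq> walk_parity A (a # ys))"
proof (induction xs)
  case (Cons x xs) then show ?case by (cases xs) auto
qed auto

lemma walk_parity_rev: "walk_parity A (rev xs) = walk_parity A xs"
proof (induction A xs rule: walk_parity.induct)
  case (1 A a b xs)
  have "walk_parity A (rev xs @ b # [a]) = (walk_parity A (rev xs @ [b]) \<noteq> walk_parity A [b, a])"
    by (rule walk_parity_append_Cons)
  with 1 show ?case by (auto simp: insert_commute)
qed auto

lemma walk_parity_append_left:
  "ys \<noteq> [] \<Longrightarrow> walk_parity A (xs @ ys) = (walk_parity A (xs @ [hd ys]) \<noteq> walk_parity A ys)"
  by (metis walk_parity_append_Cons list.collapse)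

lemma walk_parity_append_right:
  assumes "xs \<noteq> []"
  shows "walk_parity A (xs @ ys) = (walk_parity A xs \<noteq> walk_parity A (last xs # ys))"
proof -
  have "butlast xs @ last xs # ys = xs @ ys" using assms by (cases xs rule: rev_cases) auto
  then show ?thesis
    using walk_parity_append_Cons[of A "butlast xs" "last xs" ys] assms by (metis append_butlast_last_id)
qed

lemma walk_parity_join:
  assumes "xs \<noteq> []" "ys \<noteq> []" "last xs = hd ys"
  shows "walk_parity A (xs @ tl ys) = (walk_parity A xs \<noteq> walk_parity A ys)"
  using walk_parity_append_right[of xs A "tl ys"] assms by simp

lemma walk_parity_sym_diff:
  "walk_parity (sym_diff A B) xs = (walk_parity A xs \<noteq> walk_parity B xs)"
  by (induction A xs rule: walk_parity.induct) auto

section \<open>Closed walks in hyperbolic graphs\<close>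

definition cycles :: "nat \<Rightarrow> nat set set \<Rightarrow> nat \<Rightarrow> nat list set" where
  "cycles n E k = {c. length c = k \<and> distinct c \<and> is_path n E c \<and> {last c, hd c} \<in> E}"

text \<open>Lengths start at 3 because an edge traversed back and forth already fits
  \<open>cycles\<close> with \<open>k = 2\<close>.\<close>

definition short_cycles :: "nat \<Rightarrow> nat set set \<Rightarrow> nat \<Rightarrow> nat list set" where
  "short_cycles n E L = (\<Union>k\<in>{3..<L}. cycles n E k)"

text \<open>On a closed walk, \<open>p\<close> beats both arcs between the positions
  \<open>i\<close> and \<open>j\<close>; the two strict inequalities make both pieces of the split
  below shorter than \<open>w\<close>. A vertex repeated other than by closing the walk gives a
  shortcut of length 0.\<close>

definition has_shortcut :: "nat \<Rightarrow> nat set set \<Rightarrow> nat list \<Rightarrow> bool" where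
  "has_shortcut n E w \<longleftrightarrow> (\<exists>i j p. i < j \<and> j < length w \<and> is_path n E p \<and> hd p = w ! i \<and> last p = w ! j \<and>
     length p - 1 < j - i \<and> length p - 1 + (j - i) < length w - 1)"

lemma shortcut_split:
  assumes w: "is_path n E w" "hd w = last w" and "has_shortcut n E w"
  obtains w1 w2 where "is_path n E w1" "hd w1 = last w1" "length w1 < length w"
    "is_path n E w2" "hd w2 = last w2" "length w2 < length w"
    "\<And>A. walk_parity A w = (walk_parity A w1 \<noteq> walk_parity A w2)"
proof -
  obtain i j p where ij: "i < j" "j < length w" and p: "is_path n E p" "hd p = w ! i" "last p = w ! j"
    and len: "length p - 1 < j - i" "length p - 1 + (j - i) < length w - 1"
    using assms(3) unfolding has_shortcut_def by blast
  define xs where "xs = take i w"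
  define a where "a = w ! i"
  define b where "b = w ! j"
  define ys where "ys = take (j - i - 1) (drop (Suc i) w)"
  define zs where "zs = drop (Suc j) w"
  have "drop (Suc i) w = ys @ b # zs"
    using id_take_nth_drop[of "j - i - 1" "drop (Suc i) w"] ij
    by (simp add: ys_def b_def zs_def)
  then have w_eq: "w = xs @ a # ys @ b # zs"
    using id_take_nth_drop[of i w] ij by (simp add: xs_def a_def)
  have lens: "length xs = i" "length ys = j - i - 1" "length zs = length w - Suc j"
    using ij by (auto simp: xs_def ys_def zs_def)
  have p': "p \<noteq> []" "hd p = a" "last p = b" using p by (auto simp: is_path_def a_def b_def)
  \<comment> \<open>\<open>w1\<close> runs along the arc and returns along \<open>p\<close>;
    \<open>w2\<close> follows \<open>p\<close> instead of the arc. The steps of \<open>p\<close>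
    occur in both and cancel modulo 2.\<close>
  define w1 where "w1 = (a # ys) @ rev p"
  define w2 where "w2 = xs @ p @ zs"
  have pw: "is_path n E (a # ys @ [b])" "xs \<noteq> [] \<Longrightarrow> is_path n E xs" "xs \<noteq> [] \<Longrightarrow> {last xs, a} \<in> E"
    "zs \<noteq> [] \<Longrightarrow> is_path n E zs" "zs \<noteq> [] \<Longrightarrow> {b, hd zs} \<in> E"
  proof -
    define mid where "mid = a # ys @ [b]"
    have mid: "mid \<noteq> []" "hd mid = a" "last mid = b" "w = xs @ mid @ zs" by (auto simp: mid_def w_eq)
    show "is_path n E (a # ys @ [b])" "xs \<noteq> [] \<Longrightarrow> is_path n E xs" "xs \<noteq> [] \<Longrightarrow> {last xs, a} \<in> E"
      "zs \<noteq> [] \<Longrightarrow> is_path n E zs" "zs \<noteq> [] \<Longrightarrow> {b, hd zs} \<in> E"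
      using w(1) mid(1-3) unfolding mid(4) mid_def[symmetric]
      by (cases "xs = []"; cases "zs = []"; simp add: is_path_append)+
  qed
  show ?thesis
  proof
    have "w1 = (a # ys @ [b]) @ tl (rev p)" using p' by (cases p rule: rev_cases) (auto simp: w1_def)
    then show "is_path n E w1"
      using is_path_join[OF pw(1), of "rev p"] p(1) p' by (simp add: is_path_rev hd_rev)
    show "hd w1 = last w1" using p' by (simp add: w1_def last_rev)
    show "length w1 < length w" using len lens ij p'(1) by (cases p) (auto simp: w1_def)
    show "length w2 < length w" using len lens ij p'(1) by (cases p) (auto simp: w2_def)
    show "is_path n E w2" unfolding w2_def using pw p(1) p'
      by (cases "xs = []"; cases "zs = []") (auto simp: is_path_append)
    show "hd w2 = last w2" using w(2) p' unfolding w2_def w_eq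
      by (cases xs; cases zs) (auto simp: last_append)
    fix A
    have "walk_parity A w1 = (walk_parity A (a # ys @ [b]) \<noteq> walk_parity A p)"
      using walk_parity_append_left[of "rev p" A "a # ys"] p' by (simp add: w1_def hd_rev walk_parity_rev)
    moreover have "walk_parity A w2 = (walk_parity A (xs @ [a]) \<noteq> (walk_parity A p \<noteq> walk_parity A (b # zs)))"
      using walk_parity_append_left[of "p @ zs" A xs] walk_parity_append_right[of p A zs] p' by (simp add: w2_def)
    moreover have "walk_parity A w = (walk_parity A (xs @ [a]) \<noteq> (walk_parity A (a # ys @ [b]) \<noteq> walk_parity A (b # zs)))"
      using walk_parity_append_Cons[of A xs a "ys @ b # zs"] walk_parity_append_Cons[of A "a # ys" b zs]
      by (simp add: w_eq)
    ultimately show "walk_parity A w = (walk_parity A w1 \<noteq> walk_parity A w2)" by blast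
  qed
qed

lemma hd_last_segment:
  assumes "a \<le> b" "b < length w"
  shows "hd (take (Suc (b - a)) (drop a w)) = w ! a" "last (take (Suc (b - a)) (drop a w)) = w ! b"
  using assms by (auto simp: hd_drop_conv_nth last_conv_nth)

text \<open>A segment of at most half the steps is no longer than the complementary arc, so a path
  shorter than the segment beats both arcs.\<close>

lemma segment_geodesic:
  assumes w: "is_path n E w" and "\<not> has_shortcut n E w" and "a \<le> b" "b < length w" "2 * (b - a) \<le> length w - 1"
  shows "is_geodesic n E (take (Suc (b - a)) (drop a w))"
  unfolding is_geodesic_def
proof (intro conjI allI impI)
  show "is_path n E (take (Suc (b - a)) (drop a w))"
    using assms by (intro is_path_take is_path_drop) auto
  fix q assume q: "is_path n E q \<and> hd q = hd (take (Suc (b - a)) (drop a w)) \<and>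
      last q = last (take (Suc (b - a)) (drop a w))"
  show "length (take (Suc (b - a)) (drop a w)) \<le> length q"
  proof (rule ccontr)
    assume "\<not> ?thesis"
    moreover have "length q > 0" using q by (auto simp: is_path_def)
    ultimately have "length q - 1 < b - a" using assms(3,4) by (cases q) auto
    then have "has_shortcut n E w" unfolding has_shortcut_def
      using q assms hd_last_segment[OF assms(3,4)] by (intro exI[of _ a] exI[of _ b] exI[of _ q]) auto
    with assms show False by blast
  qed
qed

text \<open>A closed walk without shortcuts is an isometric cycle, so two antipodal arcs (together with
  one further edge if its length is odd) form a geodesic triangle whose arc midpoints are far from
  the other arc.\<close>

lemma long_closed_walk_has_shortcut:
  assumes hyp: "hyperbolic n E \<delta>" and D: "0 \<le> \<delta>" "\<delta> < real D"
    and w: "is_path n E w" "hd w = last w" and len: "4 * D \<le> length w - 1"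
  shows "has_shortcut n E w"
proof (rule ccontr)
  assume ns: "\<not> has_shortcut n E w"
  define k where "k = length w - 1"
  \<comment> \<open>The sides occupy the positions \<open>0..h\<close>, \<open>h..2h\<close> and
    \<open>2h..k\<close>; the last is a single vertex or a single edge according to the parity of
    \<open>k\<close>.\<close>
  define h where "h = k div 2"
  define seg where "seg a b = take (Suc (b - a)) (drop a w)" for a b
  have lw: "length w = Suc k" using w by (cases w) (auto simp: k_def is_path_def)
  have h: "2 * h \<le> k" "k \<le> 2 * h + 1" by (auto simp: h_def)
  have segs: "hd (seg a b) = w ! a" "last (seg a b) = w ! b" if "a \<le> b" "b \<le> k" for a b
    using hd_last_segment[of a b w] that lw by (auto simp: seg_def)
  have geo: "is_geodesic n E (seg a b)" if "a \<le> b" "b \<le> k" "2 * (b - a) \<le> k" for a b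
    unfolding seg_def using that lw by (intro segment_geodesic[OF w(1) ns]) auto
  have set_seg: "\<exists>j. a \<le> j \<and> j \<le> b \<and> w ! j = x" if x: "x \<in> set (seg a b)" and ab: "a \<le> b" "b \<le> k" for a b x
  proof -
    obtain i where "i < length (seg a b)" "seg a b ! i = x" using x by (auto simp: in_set_conv_nth)
    then show ?thesis using ab lw by (intro exI[of _ "a + i"]) (auto simp: seg_def)
  qed
  have ends: "w ! k = w ! 0" using w lw by (metis hd_conv_nth last_conv_nth diff_Suc_1 list.size(3) nat.distinct(1))
  \<comment> \<open>Every position in \<open>h..k\<close> is at least \<open>D\<close> steps from
    \<open>m\<close> in both directions: forwards at least \<open>h - m \<ge> m\<close>, backwards
    through 0 at least \<open>m\<close>. Halving twice and still having \<open>m \<ge> D\<close> is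
    the origin of \<open>4 * D\<close>.\<close>
  define m where "m = h div 2"
  have m: "D \<le> m" "2 * m \<le> h" using len by (auto simp: m_def h_def k_def)
  have last_arc: "2 * (k - 2 * h) \<le> k"
  proof -
    have "0 < D" using D by linarith
    then show ?thesis using len h by (auto simp: k_def)
  qed
  have "thin_triangle n E \<delta> (seg 0 h) (seg h (2 * h)) (seg (2 * h) k)"
    using hyp[unfolded hyperbolic_def, rule_format, of "seg 0 h" "seg h (2 * h)" "seg (2 * h) k"]
      geo[of 0 h] geo[of h "2 * h"] geo[of "2 * h" k] h last_arc by (simp add: segs ends)
  moreover have "w ! m \<in> set (seg 0 h)"
    using m lw h by (force simp: seg_def in_set_conv_nth intro!: exI[of _ m])
  ultimately have "in_nbhd n E (set (seg h (2 * h)) \<union> set (seg (2 * h) k)) \<delta> (w ! m)"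
    by (simp add: thin_triangle_def)
  then obtain q where q: "is_path n E q" "hd q = w ! m"
      "last q \<in> set (seg h (2 * h)) \<union> set (seg (2 * h) k)" "real (length q - 1) \<le> \<delta>"
    by (auto simp: in_nbhd_def)
  then obtain j where j: "h \<le> j" "j \<le> k" "w ! j = last q"
  proof -
    have "\<exists>j. h \<le> j \<and> j \<le> k \<and> w ! j = last q"
      using q(3)
    proof
      assume "last q \<in> set (seg h (2 * h))"
      from set_seg[OF this _ h(1)] h show ?thesis by (metis le_trans le_add1 mult_2)
    next
      assume "last q \<in> set (seg (2 * h) k)"
      from set_seg[OF this h(1) order_refl] show ?thesis by (metis le_trans le_add1 mult_2)
    qed
    then show thesis using that by blast
  qed
  have "length q - 1 < D" using q D by linarith
  then have "has_shortcut n E w" unfolding has_shortcut_def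
    using q j m lw h by (intro exI[of _ m] exI[of _ j] exI[of _ q]) auto
  with ns show False by blast
qed

text \<open>Strong induction on length: a shortcut splits \<open>w\<close> into two shorter closed
  walks whose parities add up, and a walk without shortcuts is either degenerate or one of the
  cycles assumed even.\<close>

lemma closed_walk_parity:
  assumes sg: "simple_graph n E" and hyp: "hyperbolic n E \<delta>" and D: "0 \<le> \<delta>" "\<delta> < real D"
    and even: "\<And>c. c \<in> short_cycles n E (4 * D) \<Longrightarrow> \<not> walk_parity A (c @ [hd c])"
    and w: "is_path n E w" "hd w = last w"
  shows "\<not> walk_parity A w"
  using w
proof (induction "length w" arbitrary: w rule: less_induct)
  case less
  show ?case
  proof (cases "has_shortcut n E w")
    case True
    then show ?thesis using shortcut_split[OF less.prems True] less.hyps by metis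
  next
    case False
    then have short: "length w - 1 < 4 * D"
      using long_closed_walk_has_shortcut[OF hyp D less.prems] by linarith
    have "w \<noteq> []" using less.prems by (auto simp: is_path_def)
    show ?thesis
    \<comment> \<open>At most two steps: \<open>[a, b]\<close> could close up only with a loop, and
      \<open>[a, b, a]\<close> uses one edge twice.\<close>
    proof (cases "length w \<le> 3")
      case True
      with \<open>w \<noteq> []\<close> consider a where "w = [a]" | a b where "w = [a, b]" | a b c where "w = [a, b, c]"
        by (cases w; cases "tl w"; cases "tl (tl w)") auto
      then show ?thesis
        using less.prems sg by cases (auto simp: insert_commute is_path_iff_successively simple_graph_def)
    next
      case len: False
      define c where "c = butlast w"
      have w_eq: "w = c @ [hd c]" using less.prems \<open>w \<noteq> []\<close> len
        by (cases w rule: rev_cases; cases c) (auto simp: c_def)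
      have cne: "c \<noteq> []" using len w_eq by auto
      have "distinct c"
        unfolding distinct_conv_nth
      proof (intro allI impI notI)
        fix i j assume ij: "i < length c" "j < length c" "i \<noteq> j" "c ! i = c ! j"
        \<comment> \<open>The one-vertex path is the shortcut. As \<open>c\<close> omits the last
          vertex of \<open>w\<close>, \<open>j' - i'\<close> stays below the full length, as the
          second inequality of \<open>has_shortcut\<close> demands.\<close>
        have lt: "c ! i' \<noteq> c ! j'" if "i' < j'" "j' < length c" for i' j'
        proof
          assume eq: "c ! i' = c ! j'"
          have "c ! i' \<in> set w" using that by (auto simp: w_eq)
          then have "c ! i' \<in> {1..n}" using less.prems(1) unfolding is_path_def by blast
          then have "has_shortcut n E w" unfolding has_shortcut_def
            using that eq w_eq by (intro exI[of _ i'] exI[of _ j'] exI[of _ "[c ! i']"])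
              (auto simp: is_path_def nth_append)
          with False show False by blast
        qed
        with ij show False by (metis nat_neq_iff)
      qed
      moreover have "is_path n E c" "{last c, hd c} \<in> E"
        using less.prems(1) cne by (auto simp: w_eq is_path_append)
      ultimately have "c \<in> short_cycles n E (4 * D)"
        using len short w_eq by (auto simp: short_cycles_def cycles_def)
      then show ?thesis using even w_eq by metis
    qed
  qed
qed


section \<open>Cuts and the dimension of the cycle space\<close>

lemma simple_graph_edgeE:
  assumes "simple_graph n E" "e \<in> E"
  obtains u v where "e = {u, v}" "u \<noteq> v" "u \<in> {1..n}" "v \<in> {1..n}"
  using assms by (fastforce simp: simple_graph_def card_2_iff)

lemma simple_graph_finite: "simple_graph n E \<Longrightarrow> finite E"
  by (rule finite_subset[of _ "Pow {1..n}"]) (auto simp: simple_graph_def)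

lemma finite_short_cycles: "finite (short_cycles n E L)"
proof -
  have "cycles n E k \<subseteq> {xs. set xs \<subseteq> {1..n} \<and> length xs = k}" for k
    by (auto simp: cycles_def is_path_def)
  then have "finite (cycles n E k)" for k
    using finite_lists_length_eq[of "{1..n}" k] by (meson finite_atLeastAtMost finite_subset)
  then show ?thesis by (auto simp: short_cycles_def)
qed

definition edge_cut :: "nat set set \<Rightarrow> nat set \<Rightarrow> nat set set" where
  "edge_cut E F = {e \<in> E. card (e \<inter> F) = 1}"

text \<open>Evenness on closed walks lets \<open>A\<close> integrate to a potential: its parity
  along a path from \<open>v\<close> to the root of the component. An edge lies in \<open>A\<close>
  iff its ends have different potentials, so \<open>F\<close> collects the vertices of potential
  1.\<close>

lemma even_closed_walks_imp_cut:
  assumes sg: "simple_graph n E" and "A \<subseteq> E"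
    and even: "\<And>w. is_path n E w \<Longrightarrow> hd w = last w \<Longrightarrow> \<not> walk_parity A w"
  shows "\<exists>F \<subseteq> {1..n}. A = edge_cut E F"
proof -
  define conn where "conn v u \<longleftrightarrow> (\<exists>p. is_path n E p \<and> hd p = v \<and> last p = u)" for v u
  \<comment> \<open>The graph may be disconnected; the least reachable vertex is a root shared by
    the whole component.\<close>
  define root where "root v = (LEAST u. conn v u)" for v
  define path_to_root where "path_to_root v = (SOME p. is_path n E p \<and> hd p = v \<and> last p = root v)" for v
  have ptr: "is_path n E (path_to_root v)" "hd (path_to_root v) = v" "last (path_to_root v) = root v"
    if "v \<in> {1..n}" for v
  proof -
    have "conn v v" using that unfolding conn_def
      by (intro exI[of _ "[v]"]) (auto simp: is_path_def)
    then have "conn v (root v)" unfolding root_def by (rule LeastI)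
    then have "\<exists>p. is_path n E p \<and> hd p = v \<and> last p = root v" by (simp add: conn_def)
    from someI_ex[OF this] show "is_path n E (path_to_root v)" "hd (path_to_root v) = v" "last (path_to_root v) = root v"
      by (auto simp: path_to_root_def)
  qed
  define F where "F = {v \<in> {1..n}. walk_parity A (path_to_root v)}"
  have "e \<in> A \<longleftrightarrow> card (e \<inter> F) = 1" if "e \<in> E" for e
  proof -
    obtain u v where e: "e = {u, v}" "u \<noteq> v" and uv: "u \<in> {1..n}" "v \<in> {1..n}"
      using simple_graph_edgeE[OF sg \<open>e \<in> E\<close>] by blast
    have step: "conn a z" if bz: "conn b z" "{a, b} = e" for a b z
    proof -
      obtain p where "is_path n E p" "hd p = b" "last p = z" using bz(1) by (auto simp: conn_def)
      moreover have "{a, b} \<in> E" using bz(2) \<open>e \<in> E\<close> by simp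
      moreover have "a \<in> {1..n}" using bz(2) e uv by (auto simp: doubleton_eq_iff)
      moreover from calculation have "p \<noteq> []" by (simp add: is_path_def)
      ultimately show ?thesis unfolding conn_def by (intro exI[of _ "a # p"]) (simp add: is_path_Cons)
    qed
    have "conn u = conn v" using step e by (intro ext) (metis insert_commute)
    then have root_eq: "root u = root v" by (simp add: root_def)
    \<comment> \<open>\<open>p\<close> crosses the edge from \<open>u\<close> to \<open>v\<close>
      and goes on to the root, \<open>q\<close> returns to \<open>u\<close>; evenness of this closed
      walk compares the two potentials.\<close>
    define p where "p = u # path_to_root v"
    define q where "q = rev (path_to_root u)"
    have ne: "path_to_root u \<noteq> []" "path_to_root v \<noteq> []" using ptr uv by (auto simp: is_path_def)
    have p: "is_path n E p" "hd p = u" "last p = root u" "p \<noteq> []" using ptr uv e \<open>e \<in> E\<close> root_eq ne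
      by (auto simp: p_def is_path_Cons)
    have q: "is_path n E q" "hd q = root u" "last q = u" "q \<noteq> []" using ptr uv ne
      by (auto simp: q_def is_path_rev hd_rev last_rev)
    have "is_path n E (p @ tl q)" using is_path_join p q by metis
    moreover have "hd (p @ tl q) = last (p @ tl q)" using p q by (cases q) (auto simp: last_append)
    ultimately have "\<not> walk_parity A (p @ tl q)" by (rule even)
    then have "walk_parity A p = walk_parity A q" using walk_parity_join p q by metis
    moreover have "walk_parity A p = ((e \<in> A) \<noteq> walk_parity A (path_to_root v))"
      using ne ptr(2)[OF uv(2)] e by (cases "path_to_root v") (auto simp: p_def)
    ultimately have "e \<in> A \<longleftrightarrow> (u \<in> F) \<noteq> (v \<in> F)"
      using uv by (auto simp: F_def q_def walk_parity_rev)
    also have "\<dots> \<longleftrightarrow> card (e \<inter> F) = 1" using e by (cases "u \<in> F"; cases "v \<in> F") auto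
    finally show ?thesis .
  qed
  then have "A = edge_cut E F" using \<open>A \<subseteq> E\<close> by (auto simp: edge_cut_def)
  moreover have "F \<subseteq> {1..n}" by (auto simp: F_def)
  ultimately show ?thesis by blast
qed

text \<open>An edge set is determined by the parities with which it meets the short cycles, up to the
  symmetric difference with a cut, and there are at most \<open>2 ^ n\<close> cuts.\<close>

lemma hyperbolic_card_edges_le:
  assumes sg: "simple_graph n E" and hyp: "hyperbolic n E \<delta>" and D: "0 \<le> \<delta>" "\<delta> < real D"
  shows "card E \<le> card (short_cycles n E (4 * D)) + n"
proof -
  define G where "G = short_cycles n E (4 * D)"
  define odds where "odds A = {c \<in> G. walk_parity A (c @ [hd c])}" for A
  \<comment> \<open>\<open>rep\<close> fixes one edge set for each attained parity pattern;
    \<open>side\<close> encodes by a vertex set the cut by which \<open>A\<close> differs from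
    it.\<close>
  define rep where "rep X = (SOME B. B \<subseteq> E \<and> odds B = X)" for X
  define side where "side A = (SOME F. F \<subseteq> {1..n} \<and> sym_diff A (rep (odds A)) = edge_cut E F)" for A
  have fin: "finite G" "finite E" using sg by (auto simp: G_def finite_short_cycles simple_graph_finite)
  have side: "side A \<subseteq> {1..n}" "sym_diff A (rep (odds A)) = edge_cut E (side A)" if "A \<subseteq> E" for A
  proof -
    have "rep (odds A) \<subseteq> E \<and> odds (rep (odds A)) = odds A"
      unfolding rep_def by (rule someI[of "\<lambda>B. B \<subseteq> E \<and> odds B = odds A" A]) (simp add: that)
    then have rep: "rep (odds A) \<subseteq> E" "odds (rep (odds A)) = odds A" by blast+
    have same: "walk_parity A (c @ [hd c]) = walk_parity (rep (odds A)) (c @ [hd c])" if "c \<in> G" for c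
    proof -
      have "c \<in> odds (rep (odds A)) \<longleftrightarrow> c \<in> odds A" by (simp only: rep(2))
      then show ?thesis using that unfolding odds_def by blast
    qed
    have "\<exists>F \<subseteq> {1..n}. sym_diff A (rep (odds A)) = edge_cut E F"
    proof (rule even_closed_walks_imp_cut[OF sg])
      show "sym_diff A (rep (odds A)) \<subseteq> E" using that rep by auto
      fix w assume w: "is_path n E w" "hd w = last w"
      show "\<not> walk_parity (sym_diff A (rep (odds A))) w"
        using same by (rule_tac closed_walk_parity[OF sg hyp D _ w]) (auto simp: walk_parity_sym_diff G_def)
    qed
    from someI_ex[OF this] have "side A \<subseteq> {1..n} \<and> sym_diff A (rep (odds A)) = edge_cut E (side A)"
      unfolding side_def .
    then show "side A \<subseteq> {1..n}" "sym_diff A (rep (odds A)) = edge_cut E (side A)" by blast+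
  qed
  have "inj_on (\<lambda>A. (odds A, side A)) (Pow E)"
  proof (rule inj_onI)
    fix A B assume AB: "A \<in> Pow E" "B \<in> Pow E" "(odds A, side A) = (odds B, side B)"
    then have "sym_diff A (rep (odds A)) = sym_diff B (rep (odds A))" using side[of A] side[of B] by auto
    then show "A = B" by blast
  qed
  moreover have "(\<lambda>A. (odds A, side A)) ` Pow E \<subseteq> Pow G \<times> Pow {1..n}"
    using side(1) by (auto simp: odds_def)
  ultimately have "card (Pow E) \<le> card (Pow G \<times> Pow {1..n})"
    using fin by (intro card_inj_on_le) auto
  then have "(2::nat) ^ card E \<le> 2 ^ (card G + n)"
    using fin by (simp add: card_Pow card_cartesian_product power_add)
  then show ?thesis by (simp add: G_def)
qed

lemma handshake:
  assumes "simple_graph n E" "regular n d E"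
  shows "n * d = 2 * card E"
proof -
  have "{v \<in> {1..n}. v \<in> e} = e" if "e \<in> E" for e using that assms(1) by (fastforce simp: simple_graph_def)
  then have "(\<Sum>v\<in>{1..n}. card {e \<in> E. v \<in> e}) = 2 * card E"
    using assms simple_graph_finite[OF assms(1)] by (intro sum_multicount) (auto simp: simple_graph_def)
  then show ?thesis using assms by (simp add: regular_def)
qed

section \<open>Short cycles in random regular graphs\<close>

definition nbrs :: "nat set set \<Rightarrow> nat \<Rightarrow> nat set" where
  "nbrs E v = {w. {v, w} \<in> E}"

lemma nbrs_subset: "simple_graph n E \<Longrightarrow> nbrs E v \<subseteq> {1..n}"
  by (auto simp: nbrs_def simple_graph_def)

lemma finite_nbrs: "simple_graph n E \<Longrightarrow> finite (nbrs E v)"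
  by (rule finite_subset[OF nbrs_subset]) auto

lemma card_incident_edges:
  assumes "simple_graph n E"
  shows "card {e \<in> E. v \<in> e} = card (nbrs E v)"
proof -
  have "inj_on (\<lambda>w. {v, w}) (nbrs E v)" by (auto simp: inj_on_def doubleton_eq_iff)
  moreover have "(\<lambda>w. {v, w}) ` nbrs E v = {e \<in> E. v \<in> e}"
  proof (intro equalityI subsetI)
    fix e assume e: "e \<in> {e \<in> E. v \<in> e}"
    then obtain a b where "e = {a, b}" using simple_graph_edgeE[OF assms, of e] by blast
    with e show "e \<in> (\<lambda>w. {v, w}) ` nbrs E v" by (auto simp: nbrs_def insert_commute)
  qed (auto simp: nbrs_def)
  ultimately show ?thesis by (metis card_image)
qed

lemma regular_graphs_iff:
  "E \<in> regular_graphs n d \<longleftrightarrow> simple_graph n E \<and> (\<forall>v\<in>{1..n}. card (nbrs E v) = d)"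
  by (auto simp: regular_graphs_def regular_def card_incident_edges)

lemma finite_regular_graphs: "finite (regular_graphs n d)"
  by (rule finite_subset[of _ "Pow (Pow {1..n})"]) (auto simp: regular_graphs_def simple_graph_def)

lemma card_arcs_from:
  assumes "E \<in> regular_graphs n d" "S \<subseteq> {1..n}"
  shows "card (SIGMA x:S. nbrs E x) = card S * d"
proof -
  have "finite S" using assms(2) finite_subset by blast
  moreover have deg: "\<forall>x\<in>S. card (nbrs E x) = d" and "\<forall>x\<in>S. finite (nbrs E x)"
    using assms finite_nbrs unfolding regular_graphs_iff by blast+
  ultimately have "card (SIGMA x:S. nbrs E x) = (\<Sum>x\<in>S. card (nbrs E x))" by (intro card_SigmaI)
  also have "\<dots> = (\<Sum>x\<in>S. d)" using deg by (intro sum.cong) auto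
  finally show ?thesis by simp
qed

definition walks :: "nat \<Rightarrow> nat set set \<Rightarrow> nat \<Rightarrow> nat list set" where
  "walks n E k = {p. length p = k \<and> is_path n E p}"

lemma finite_walks: "finite (walks n E k)"
  by (rule finite_subset[OF _ finite_lists_length_eq[of "{1..n}" k]]) (auto simp: walks_def is_path_def)

lemma card_walks_le:
  assumes "E \<in> regular_graphs n d"
  shows "card (walks n E (Suc k)) \<le> n * d ^ k"
proof (induction k)
  case 0
  have "walks n E (Suc 0) = (\<lambda>a. [a]) ` {1..n}"
    by (auto simp: walks_def is_path_def length_Suc_conv)
  then show ?case using card_image_le[of "{1..n}" "\<lambda>a. [a]"] by simp
next
  case (Suc k)
  have sub: "walks n E (Suc (Suc k)) \<subseteq> (\<lambda>(p, a). a # p) ` (SIGMA p:walks n E (Suc k). nbrs E (hd p))"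
  proof
    fix p assume p: "p \<in> walks n E (Suc (Suc k))"
    then obtain a q where "p = a # q" "length q = Suc k" by (auto simp: walks_def length_Suc_conv)
    then show "p \<in> (\<lambda>(p, a). a # p) ` (SIGMA p:walks n E (Suc k). nbrs E (hd p))"
      using p by (force simp: walks_def is_path_Cons nbrs_def insert_commute)
  qed
  have nb: "finite (nbrs E v)" for v using assms finite_nbrs by (auto simp: regular_graphs_iff)
  have "card (walks n E (Suc (Suc k))) \<le> card (SIGMA p:walks n E (Suc k). nbrs E (hd p))"
    using sub by (intro surj_card_le) (auto simp: finite_walks nb)
  also have "\<dots> = (\<Sum>p\<in>walks n E (Suc k). card (nbrs E (hd p)))"
    by (intro card_SigmaI) (auto simp: finite_walks nb)
  also have "\<dots> = (\<Sum>p\<in>walks n E (Suc k). d)"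
    using assms by (intro sum.cong) (auto simp: walks_def is_path_def regular_graphs_iff dest!: hd_in_set)
  also have "\<dots> \<le> n * d ^ Suc k" using Suc by (simp add: mult_ac)
  finally show ?case .
qed

section \<open>Switchings and the mean number of cycles\<close>

definition switch :: "nat set set \<Rightarrow> nat \<Rightarrow> nat \<Rightarrow> nat \<Rightarrow> nat \<Rightarrow> nat set set" where
  "switch E u v x y = (E - {{u, v}, {x, y}}) \<union> {{u, x}, {v, y}}"

text \<open>Each of the four vertices trades one neighbour for another, and the non-adjacencies make
  the new neighbour genuinely new, so no degree drops.\<close>

lemma switch_regular:
  assumes E: "E \<in> regular_graphs n d" and dist: "distinct [u, v, x, y]"
    and "{u, v} \<in> E" "{x, y} \<in> E" "{u, x} \<notin> E" "{v, y} \<notin> E"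
  shows "switch E u v x y \<in> regular_graphs n d"
proof -
  have sg: "simple_graph n E" and deg: "\<And>v. v \<in> {1..n} \<Longrightarrow> card (nbrs E v) = d"
    using E by (auto simp: regular_graphs_iff)
  have "u \<in> {1..n}" "v \<in> {1..n}" "x \<in> {1..n}" "y \<in> {1..n}"
    using sg assms(3,4) by (auto simp: simple_graph_def)
  then have sg': "simple_graph n (switch E u v x y)"
    using sg dist by (auto simp: simple_graph_def switch_def)
  have swap: "card (insert b (nbrs E z - {a})) = card (nbrs E z)" if "a \<in> nbrs E z" "b \<notin> nbrs E z" for a b z
    using that finite_nbrs[OF sg, of z] card_Suc_Diff1[of "nbrs E z" a] by simp
  have "card (nbrs (switch E u v x y) z) = card (nbrs E z)" for z
  proof -
    consider "z = u" | "z = v" | "z = x" | "z = y" | "z \<notin> {u, v, x, y}" by blast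
    then show ?thesis
    proof cases
      case 1
      then have "nbrs (switch E u v x y) z = insert x (nbrs E z - {v})"
        using dist by (auto simp: nbrs_def switch_def doubleton_eq_iff)
      then show ?thesis using swap[of v z x] assms 1 by (simp add: nbrs_def)
    next
      case 2
      then have "nbrs (switch E u v x y) z = insert y (nbrs E z - {u})"
        using dist by (auto simp: nbrs_def switch_def doubleton_eq_iff)
      then show ?thesis using swap[of u z y] assms 2 by (simp add: nbrs_def insert_commute)
    next
      case 3
      then have "nbrs (switch E u v x y) z = insert u (nbrs E z - {y})"
        using dist by (auto simp: nbrs_def switch_def doubleton_eq_iff)
      then show ?thesis using swap[of y z u] assms 3 by (simp add: nbrs_def insert_commute)
    next
      case 4
      then have "nbrs (switch E u v x y) z = insert v (nbrs E z - {x})"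
        using dist by (auto simp: nbrs_def switch_def doubleton_eq_iff)
      then show ?thesis using swap[of x z v] assms 4 by (simp add: nbrs_def insert_commute)
    next
      case 5
      then have "nbrs (switch E u v x y) z = nbrs E z"
        by (auto simp: nbrs_def switch_def doubleton_eq_iff)
      then show ?thesis by simp
    qed
  qed
  then show ?thesis using sg' deg by (simp add: regular_graphs_iff)
qed

text \<open>Pairs are ordered because the orientation decides which end is joined to
  \<open>hd c\<close>. Avoiding \<open>set c\<close> protects the remaining edges of
  \<open>c\<close>.\<close>

definition switchable :: "nat set set \<Rightarrow> nat list \<Rightarrow> (nat \<times> nat) set" where
  "switchable E c = {(x, y). {x, y} \<in> E \<and> x \<notin> set c \<and> y \<notin> set c \<and> {hd c, x} \<notin> E \<and> {last c, y} \<notin> E}"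

text \<open>Of the \<open>n * d\<close> arcs, at most \<open>2 * k * d\<close> have an end on
  \<open>c\<close>, at most \<open>d * d\<close> start at a neighbour of \<open>hd c\<close>, and at
  most \<open>d * d\<close> end at a neighbour of \<open>last c\<close>.\<close>

lemma card_switchable_ge:
  assumes E: "E \<in> regular_graphs n d" and c: "c \<in> cycles n E k"
  shows "n * d \<le> card (switchable E c) + 2 * d * (k + d)"
proof -
  have sg: "simple_graph n E" using E by (simp add: regular_graphs_iff)
  have nb: "finite (nbrs E v)" "nbrs E v \<subseteq> {1..n}" for v using finite_nbrs[OF sg] nbrs_subset[OF sg] by auto
  define arcs where "arcs S = (SIGMA x:S. nbrs E x)" for S
  have c': "set c \<subseteq> {1..n}" "c \<noteq> []" "card (set c) = k"
    using c by (auto simp: cycles_def is_path_def distinct_card)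
  then have ends: "hd c \<in> {1..n}" "last c \<in> {1..n}" using hd_in_set last_in_set by blast+
  have card_arcs: "card (arcs S) = card S * d" "card ((arcs S)\<inverse>) = card S * d" if "S \<subseteq> {1..n}" for S
    using card_arcs_from[OF E that] by (auto simp: arcs_def)
  have deg: "card (nbrs E (hd c)) = d" "card (nbrs E (last c)) = d" using ends E by (auto simp: regular_graphs_iff)
  have fin: "finite (arcs {1..n})" by (auto simp: arcs_def nb)
  have "switchable E c \<subseteq> arcs {1..n}"
    using sg by (auto simp: switchable_def arcs_def nbrs_def simple_graph_def)
  then have fin_sw: "finite (switchable E c)" using fin finite_subset by blast
  have fin_arcs: "finite (arcs S)" if "S \<subseteq> {1..n}" for S
    using that by (intro finite_subset[OF _ fin]) (auto simp: arcs_def)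
  let ?U = "arcs (set c) \<union> (arcs (set c))\<inverse> \<union> arcs (nbrs E (hd c)) \<union> (arcs (nbrs E (last c)))\<inverse>"
  have "arcs {1..n} \<subseteq> switchable E c \<union> ?U"
    by (auto simp: arcs_def switchable_def nbrs_def insert_commute)
  then have "card (arcs {1..n}) \<le> card (switchable E c \<union> ?U)"
    using fin_sw fin_arcs c' nb by (intro card_mono) auto
  also have "\<dots> \<le> card (switchable E c) + (card (arcs (set c)) + card ((arcs (set c))\<inverse>)
      + card (arcs (nbrs E (hd c))) + card ((arcs (nbrs E (last c)))\<inverse>))"
    by (intro order_trans[OF card_Un_le] add_mono order_refl)
  also have "\<dots> = card (switchable E c) + 2 * d * (k + d)"
    using c' nb deg by (simp add: card_arcs algebra_simps)
  finally show ?thesis using card_arcs[of "{1..n}"] by simp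
qed

lemma switch_cycle:
  assumes E: "E \<in> regular_graphs n d" and c: "c \<in> cycles n E k" and "3 \<le> k" and xy: "(x, y) \<in> switchable E c"
  shows "switch E (hd c) (last c) x y \<in> regular_graphs n d"
    and "c \<in> walks n (switch E (hd c) (last c) x y) k"
    and "(switch E (hd c) (last c) x y - {{hd c, x}, {last c, y}}) \<union> {{hd c, last c}, {x, y}} = E"
proof -
  have c': "length c = k" "distinct c" "is_path n E c" "{last c, hd c} \<in> E" "c \<noteq> []"
    using c by (auto simp: cycles_def is_path_def)
  have xy': "{x, y} \<in> E" "x \<notin> set c" "y \<notin> set c" "{hd c, x} \<notin> E" "{last c, y} \<notin> E"
    using xy by (auto simp: switchable_def)
  have ends: "hd c = c ! 0" "last c = c ! (k - 1)" using c' by (auto simp: hd_conv_nth last_conv_nth)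
  have "x \<noteq> y" using xy'(1) E by (auto simp: regular_graphs_iff simple_graph_def)
  moreover have "hd c \<noteq> last c" using c' \<open>3 \<le> k\<close> by (auto simp: ends nth_eq_iff_index_eq)
  moreover have "hd c \<in> set c" "last c \<in> set c" using c' by auto
  ultimately have "distinct [hd c, last c, x, y]" using xy' by auto
  then show "switch E (hd c) (last c) x y \<in> regular_graphs n d"
    using switch_regular[OF E] xy' c' by (simp add: insert_commute)
  have "{c ! i, c ! Suc i} \<in> switch E (hd c) (last c) x y" if "Suc i < length c" for i
  proof -
    \<comment> \<open>With \<open>k \<ge> 3\<close> the closing edge is not also a step of the path
      \<open>c\<close>.\<close>
    have "{c ! i, c ! Suc i} \<noteq> {hd c, last c}"
      using that c' \<open>3 \<le> k\<close> by (auto simp: ends doubleton_eq_iff nth_eq_iff_index_eq)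
    moreover have "{c ! i, c ! Suc i} \<noteq> {x, y}" using that xy' nth_mem[of i c] nth_mem[of "Suc i" c]
      by (auto simp: doubleton_eq_iff)
    moreover have "{c ! i, c ! Suc i} \<in> E" using c' that by (auto simp: is_path_def)
    ultimately show ?thesis by (auto simp: switch_def)
  qed
  then show "c \<in> walks n (switch E (hd c) (last c) x y) k"
    using c' by (auto simp: walks_def is_path_def)
  show "(switch E (hd c) (last c) x y - {{hd c, x}, {last c, y}}) \<union> {{hd c, last c}, {x, y}} = E"
    using xy' c' unfolding switch_def by (auto simp: insert_commute)
qed

text \<open>Switching at the edge that closes a cycle \<open>c\<close> keeps \<open>c\<close> as a walk.  Each pair of a graph and a
  \<open>k\<close>-cycle admits at least \<open>n\<close> switchings, each of which is recovered from the new graph, the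
  walk \<open>c\<close> and the endpoints of the two new edges.\<close>

lemma card_regular_graphs_cycles_le:
  assumes "2 \<le> d" "3 \<le> k" "0 < n" "2 * d * (k + d) \<le> n"
  shows "(\<Sum>E\<in>regular_graphs n d. card (cycles n E k)) \<le> card (regular_graphs n d) * d ^ (k + 1)"
proof -
  define R where "R = regular_graphs n d"
  define src where "src = (SIGMA z:(SIGMA E:R. cycles n E k). switchable (fst z) (snd z))"
  define tgt where "tgt = (SIGMA E:R. SIGMA c:walks n E k. nbrs E (hd c) \<times> nbrs E (last c))"
  define f where "f = (\<lambda>((E, c), (x, y)). (switch E (hd c) (last c) x y, c, x, y))"
  define g where "g = (\<lambda>(E, c, x, y). ((E - {{hd c, x}, {last c, y}} \<union> {{hd c, last c}, {x, y :: nat}}, c), (x, y)))"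
  have finR: "finite R" by (simp add: R_def finite_regular_graphs)
  have nb: "finite (nbrs E v)" if "E \<in> R" for E v
    using that finite_nbrs[of n E v] by (simp add: R_def regular_graphs_iff)
  have cyc: "cycles n E k \<subseteq> walks n E k" for E by (auto simp: cycles_def walks_def)
  have fin_cyc: "finite (cycles n E k)" for E by (rule finite_subset[OF cyc finite_walks])
  have fin_sw: "finite (switchable E c)" if "E \<in> R" for E c
  proof (rule finite_subset)
    show "switchable E c \<subseteq> {1..n} \<times> {1..n}"
      using that by (auto simp: switchable_def R_def regular_graphs_iff simple_graph_def)
  qed auto
  have sw_ge: "n \<le> card (switchable E c)" if "E \<in> R" "c \<in> cycles n E k" for E c
  proof -
    \<comment> \<open>At most \<open>n\<close> of the \<open>n * d\<close> arcs are lost, and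
      \<open>d \<ge> 2\<close> leaves at least \<open>n\<close>.\<close>
    have "n * d \<le> card (switchable E c) + n"
      using card_switchable_ge[of E n d c k] that assms(4) by (simp add: R_def)
    moreover have "n * 2 \<le> n * d" using assms(1) by simp
    ultimately show ?thesis by linarith
  qed
  have f_tgt: "f ` src \<subseteq> tgt"
  proof
    fix t assume "t \<in> f ` src"
    then obtain E c x y where E: "E \<in> R" "c \<in> cycles n E k" "(x, y) \<in> switchable E c"
      and t: "t = (switch E (hd c) (last c) x y, c, x, y)"
      by (auto simp: src_def f_def)
    show "t \<in> tgt"
      using switch_cycle[of E n d c k x y] E \<open>3 \<le> k\<close> by (auto simp: t tgt_def R_def nbrs_def switch_def)
  qed
  have "g (f z) = z" if z_src: "z \<in> src" for z
  proof -
    obtain E c x y where E: "E \<in> R" "c \<in> cycles n E k" "(x, y) \<in> switchable E c" and z: "z = ((E, c), (x, y))"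
      using z_src by (auto simp: src_def)
    show ?thesis using switch_cycle(3)[of E n d c k x y] E \<open>3 \<le> k\<close> by (simp add: z f_def g_def R_def)
  qed
  then have inj: "inj_on f src" by (rule inj_on_inverseI)
  have fin_tgt: "finite tgt" unfolding tgt_def
    by (intro finite_SigmaI finite_cartesian_product finR finite_walks nb)
  have "(\<Sum>E\<in>R. card (cycles n E k)) * n = (\<Sum>E\<in>R. \<Sum>c\<in>cycles n E k. n)"
    by (simp add: sum_distrib_right)
  also have "\<dots> \<le> (\<Sum>E\<in>R. \<Sum>c\<in>cycles n E k. card (switchable E c))"
    by (intro sum_mono sw_ge)
  also have "\<dots> = (\<Sum>z\<in>(SIGMA E:R. cycles n E k). card (switchable (fst z) (snd z)))"
    using finR fin_cyc by (subst sum.Sigma) (auto simp: case_prod_unfold)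
  also have "\<dots> = card src" unfolding src_def
    by (rule card_SigmaI[symmetric]) (auto simp: finR fin_cyc fin_sw)
  also have "\<dots> \<le> card tgt" by (rule card_inj_on_le[OF inj f_tgt fin_tgt])
  also have "\<dots> = (\<Sum>E\<in>R. card (SIGMA c:walks n E k. nbrs E (hd c) \<times> nbrs E (last c)))"
    unfolding tgt_def by (rule card_SigmaI) (auto simp: finR finite_walks nb)
  \<comment> \<open>At most \<open>n * d ^ (k - 1)\<close> walks on \<open>k\<close> vertices, times
    \<open>d\<close> choices each for \<open>x\<close> and \<open>y\<close>, now neighbours of the
    two ends.\<close>
  also have "\<dots> \<le> (\<Sum>E\<in>R. n * d ^ (k + 1))"
  proof (rule sum_mono)
    fix E assume E: "E \<in> R"
    have "card (SIGMA c:walks n E k. nbrs E (hd c) \<times> nbrs E (last c))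
        = (\<Sum>c\<in>walks n E k. card (nbrs E (hd c) \<times> nbrs E (last c)))"
      by (rule card_SigmaI) (auto simp: finite_walks nb[OF E])
    also have "\<dots> = (\<Sum>c\<in>walks n E k. d * d)"
    proof (rule sum.cong)
      fix c assume "c \<in> walks n E k"
      then have "hd c \<in> {1..n}" "last c \<in> {1..n}" using hd_in_set[of c] last_in_set[of c]
        unfolding walks_def is_path_def by blast+
      then show "card (nbrs E (hd c) \<times> nbrs E (last c)) = d * d"
        using E by (simp add: card_cartesian_product R_def regular_graphs_iff)
    qed simp
    also have "\<dots> \<le> n * d ^ (k - 1) * (d * d)"
      using card_walks_le[of E n d "k - 1"] E \<open>3 \<le> k\<close> by (simp add: R_def)
    also have "\<dots> = n * d ^ (k + 1)"
      using \<open>3 \<le> k\<close> by (cases k) auto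
    finally show "card (SIGMA c:walks n E k. nbrs E (hd c) \<times> nbrs E (last c)) \<le> n * d ^ (k + 1)" .
  qed
  also have "\<dots> = card R * d ^ (k + 1) * n" by simp
  finally show ?thesis using \<open>0 < n\<close> by (simp add: R_def)
qed

lemma hyperbolic_regular_graphs_le:
  assumes "3 \<le> d" "0 \<le> \<delta>" "\<delta> < real D" "0 < n" "2 * d * (4 * D + d) \<le> n"
  shows "card {E \<in> regular_graphs n d. hyperbolic n E \<delta>} * n
    \<le> 2 * (card (regular_graphs n d) * (\<Sum>k<4 * D. d ^ (k + 1)))"
proof -
  define R where "R = regular_graphs n d"
  have finR: "finite R" by (simp add: R_def finite_regular_graphs)
  have many: "n \<le> 2 * card (short_cycles n E (4 * D))" if "E \<in> R" "hyperbolic n E \<delta>" for E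
  proof -
    have E: "simple_graph n E" "regular n d E" using that by (auto simp: R_def regular_graphs_def)
    \<comment> \<open>Degree 3 is decisive: after \<open>2 * n\<close> is given up for the cuts,
      \<open>n\<close> remains.\<close>
    have "n * 3 \<le> n * d" using assms(1) by simp
    also have "\<dots> = 2 * card E" by (rule handshake[OF E])
    also have "\<dots> \<le> 2 * (card (short_cycles n E (4 * D)) + n)"
      using hyperbolic_card_edges_le[OF E(1) that(2) assms(2,3)] by simp
    finally show ?thesis by simp
  qed
  have "card {E \<in> R. hyperbolic n E \<delta>} * n = (\<Sum>E | E \<in> R \<and> hyperbolic n E \<delta>. n)" by simp
  also have "\<dots> \<le> (\<Sum>E | E \<in> R \<and> hyperbolic n E \<delta>. 2 * card (short_cycles n E (4 * D)))"
    using many by (intro sum_mono) auto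
  also have "\<dots> \<le> (\<Sum>E\<in>R. 2 * card (short_cycles n E (4 * D)))"
    using finR by (intro sum_mono2) auto
  also have "\<dots> = 2 * (\<Sum>E\<in>R. card (short_cycles n E (4 * D)))" by (simp add: sum_distrib_left)
  also have "(\<Sum>E\<in>R. card (short_cycles n E (4 * D))) \<le> (\<Sum>E\<in>R. \<Sum>k\<in>{3..<4 * D}. card (cycles n E k))"
    unfolding short_cycles_def by (intro sum_mono card_UN_le) auto
  also have "\<dots> = (\<Sum>k\<in>{3..<4 * D}. \<Sum>E\<in>R. card (cycles n E k))" by (rule sum.swap)
  also have "\<dots> \<le> (\<Sum>k\<in>{3..<4 * D}. card R * d ^ (k + 1))"
  proof (rule sum_mono)
    fix k assume k: "k \<in> {3..<4 * D}"
    have "2 * d * (k + d) \<le> 2 * d * (4 * D + d)" using k by (intro mult_left_mono) auto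
    also note assms(5)
    finally show "(\<Sum>E\<in>R. card (cycles n E k)) \<le> card R * d ^ (k + 1)"
      unfolding R_def using assms k by (intro card_regular_graphs_cycles_le) auto
  qed
  also have "\<dots> \<le> (\<Sum>k<4 * D. card R * d ^ (k + 1))" by (intro sum_mono2) auto
  also have "\<dots> = card R * (\<Sum>k<4 * D. d ^ (k + 1))" by (simp add: sum_distrib_left)
  finally show ?thesis by (simp add: R_def)
qed

section \<open>Existence of regular graphs\<close>

text \<open>Circulant graphs; \<open>S\<close> is the set of differences modulo \<open>n\<close> of adjacent vertices.\<close>

lemma regular_graphs_nonempty:
  assumes "d < n" "even (n * d)"
  shows "regular_graphs n d \<noteq> {}"
proof -
  obtain S where S: "S \<subseteq> {1..<int n}" "card S = d" and sym: "\<And>s. s \<in> S \<Longrightarrow> int n - s \<in> S"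
  proof (cases "even d")
    case True
    then obtain h where h: "d = 2 * h" by blast
    \<comment> \<open>The differences are 1, ..., \<open>h\<close> and their negatives modulo
      \<open>n\<close>; \<open>d < n\<close> keeps the two blocks disjoint.\<close>
    have "{1..int h} \<inter> {int n - int h..<int n} = {}" using assms h by auto
    then have "card ({1..int h} \<union> {int n - int h..<int n}) = d" using h by (subst card_Un_disjoint) auto
    then show ?thesis using assms h by (intro that[of "{1..int h} \<union> {int n - int h..<int n}"]) auto
  next
    case False
    \<comment> \<open>Here \<open>n\<close> is even, and \<open>S\<close> becomes an interval of
      \<open>d\<close> differences centred at \<open>n / 2\<close>, which is its own negative modulo
      \<open>n\<close>.\<close>
    then have "even (n + 1 - d)" using assms by auto
    then obtain a where "n + 1 - d = 2 * a" by blast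
    then have a: "n + 1 = 2 * a + d" "1 \<le> a" using assms by auto
    then show ?thesis by (intro that[of "{int a..int n - int a}"]) auto
  qed
  define E where "E = {{i, j} | i j. i \<in> {1..n} \<and> j \<in> {1..n} \<and> (int j - int i) mod int n \<in> S}"
  have n: "0 < int n" using assms by auto
  have sym': "(int i - int j) mod int n \<in> S" if "(int j - int i) mod int n \<in> S" for i j
  proof -
    have "(int j - int i) mod int n \<noteq> 0" using that S by auto
    then have "(int i - int j) mod int n = int n - (int j - int i) mod int n"
      using zmod_zminus1_eq_if[of "int j - int i" "int n"] by simp
    then show ?thesis using sym[OF that] by simp
  qed
  have edge: "{i, j} \<in> E \<longleftrightarrow> i \<in> {1..n} \<and> j \<in> {1..n} \<and> (int j - int i) mod int n \<in> S" for i j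
    using sym' by (auto simp: E_def doubleton_eq_iff)
  have irrefl: "i \<noteq> j" if "(int j - int i) mod int n \<in> S" for i j using that S by auto
  have "simple_graph n E" using irrefl by (fastforce simp: simple_graph_def E_def card_2_iff)
  moreover have "card (nbrs E i) = d" if i: "i \<in> {1..n}" for i
  proof -
    have "bij_betw (\<lambda>j. (int j - int i) mod int n) (nbrs E i) S"
      unfolding bij_betw_def
    proof
      show "inj_on (\<lambda>j. (int j - int i) mod int n) (nbrs E i)"
      proof (rule inj_onI)
        fix j j' assume j: "j \<in> nbrs E i" "j' \<in> nbrs E i"
          and "(int j - int i) mod int n = (int j' - int i) mod int n"
        then have "int n dvd (int j - int i) - (int j' - int i)" by (simp add: mod_eq_dvd_iff)
        then have "int n dvd int j - int j'" by simp
        moreover have "\<bar>int j - int j'\<bar> < int n" using j by (auto simp: nbrs_def edge)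
        ultimately show "j = j'" using zdvd_not_zless[of "\<bar>int j - int j'\<bar>" "int n"] by auto
      qed
      have "s \<in> (\<lambda>j. (int j - int i) mod int n) ` nbrs E i" if s: "s \<in> S" for s
      proof -
        \<comment> \<open>Vertices are \<open>1..n\<close> rather than \<open>0..n - 1\<close>,
          hence the shift by one around \<open>mod\<close>.\<close>
        define j where "j = nat (1 + (int i + s - 1) mod int n)"
        have m: "0 \<le> (int i + s - 1) mod int n" "(int i + s - 1) mod int n < int n" using n by auto
        then have j: "int j = 1 + (int i + s - 1) mod int n" "j \<in> {1..n}" by (auto simp: j_def)
        have "(int j - int i) mod int n = ((int i + s - 1) mod int n + (1 - int i)) mod int n"
          by (simp add: j(1) algebra_simps)
        also have "\<dots> = ((int i + s - 1) + (1 - int i)) mod int n" by (rule mod_add_left_eq)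
        also have "\<dots> = s" using s S(1) by auto
        finally show ?thesis using s i j(2) by (intro image_eqI[of _ _ j]) (auto simp: nbrs_def edge)
      qed
      then show "(\<lambda>j. (int j - int i) mod int n) ` nbrs E i = S" by (auto simp: nbrs_def edge)
    qed
    then show ?thesis using S(2) bij_betw_same_card by blast
  qed
  ultimately have "E \<in> regular_graphs n d" by (simp add: regular_graphs_iff)
  then show ?thesis by blast
qed

theorem mainTheorem3:
  fixes d :: nat and \<delta> :: real
  assumes "d \<ge> 3" and "\<delta> \<ge> 0"
  shows "((\<lambda>n. measure_pmf.prob (pmf_of_set (regular_graphs n d)) {E. hyperbolic n E \<delta>})
            \<longlongrightarrow> 0) (inf sequentially (principal {n. even (n * d)}))"
proof -
  obtain D :: nat where D: "\<delta> < real D" using reals_Archimedean2 by blast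
  define B where "B = (\<Sum>k<4 * D. d ^ (k + 1))"
  \<comment> \<open>The first summand is what the switching count demands for all lengths below
    \<open>4 * D\<close>; \<open>d + 1\<close> ensures \<open>d < n\<close>, as the circulant graphs
    require.\<close>
  define N where "N = 2 * d * (4 * D + d) + d + 1"
  have bound: "measure_pmf.prob (pmf_of_set (regular_graphs n d)) {E. hyperbolic n E \<delta>} \<le> real (2 * B) / real n"
    if n: "N \<le> n" "even (n * d)" for n
  proof -
    \<comment> \<open>The uniform distribution makes sense only on a nonempty set, and its
      cardinality becomes a denominator below.\<close>
    have ne: "regular_graphs n d \<noteq> {}" using n by (intro regular_graphs_nonempty) (auto simp: N_def)
    have "card {E \<in> regular_graphs n d. hyperbolic n E \<delta>} * n \<le> 2 * (card (regular_graphs n d) * B)"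
      unfolding B_def using n D assms by (intro hyperbolic_regular_graphs_le) (auto simp: N_def)
    then have "real (card {E \<in> regular_graphs n d. hyperbolic n E \<delta>} * n) \<le> real (2 * (card (regular_graphs n d) * B))"
      by (rule of_nat_mono)
    then have "real (card {E \<in> regular_graphs n d. hyperbolic n E \<delta>}) * real n
        \<le> real (2 * B) * real (card (regular_graphs n d))" by (simp add: mult_ac)
    moreover have "0 < card (regular_graphs n d)" using ne finite_regular_graphs by (simp add: card_gt_0_iff)
    moreover have "0 < n" using n by (simp add: N_def)
    moreover have "regular_graphs n d \<inter> {E. hyperbolic n E \<delta>} = {E \<in> regular_graphs n d. hyperbolic n E \<delta>}" by auto
    ultimately show ?thesis
      by (simp add: measure_pmf_of_set[OF ne finite_regular_graphs] frac_le_eq divide_simps)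
  qed
  show ?thesis
  proof (rule tendsto_sandwich[OF always_eventually _ tendsto_const])
    show "\<forall>\<^sub>F n in inf sequentially (principal {n. even (n * d)}).
        measure_pmf.prob (pmf_of_set (regular_graphs n d)) {E. hyperbolic n E \<delta>} \<le> real (2 * B) / real n"
      unfolding eventually_inf_principal
      using eventually_ge_at_top[of N] by (rule eventually_mono) (use bound in blast)
    show "((\<lambda>n. real (2 * B) / real n) \<longlongrightarrow> 0) (inf sequentially (principal {n. even (n * d)}))"
      by (rule tendsto_mono[OF inf_le1 lim_const_over_n])
  qed auto
qed

end
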